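(* Let $X,Y$ be Banach spaces and let $\tau$ be one of the following topologies on $X$: the norm topology, the weak topology, or, provided that $X$ is a dual space, the weak$^*$ topology. Let $F$, $\Omega$, $y$, $\alpha\in[0,\infty)$, $p\in[1,\infty)$, $(F_n)_{n\in\mathbb{N}}$, $(y_n)_{n\in\mathbb{N}}$, $(\alpha_n)_{n\in\mathbb{N}}$ satisfy all the standing assumptions listed in the context (relative to $\tau$), and let $T$ and $T_n$ be the associated Tikhonov functionals $$T(x)=\begin{cases}\frac1p\|F(x)-y\|_Y^p+\alpha\,\Omega(x), & x\in\operatorname{dom}(F),\\ +\infty, &\text{otherwise,}\end{cases}\qquad T_n(x)=\begin{cases}\frac1p\|F_n(x)-y_n\|_Y^p+\alpha_n\,\Omega(x), & x\in\operatorname{dom}(F_n),\\ +\infty, &\text{otherwise,}\end{cases}$$ for $x\in X$. Then $(T_n)_{n\in\mathbb{N}}$ $\Gamma$-converges to $T$ on $X$ with respect to $\tau$.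
   Context: Standing assumptions. $X,Y$ are Banach spaces and $\tau$ is the norm topology, the weak topology or (if $X$ is a dual space) the weak$^*$ topology on $X$. (1) $F:\operatorname{dom}(F)\to Y$ is a (not necessarily linear) operator with $\emptyset\ne\operatorname{dom}(F)\subseteq X$, such that for every $z\in Y$ the function $X\to\mathbb{R}\cup\{+\infty\}$ given by $x\mapsto\|F(x)-z\|_Y$ if $x\in\operatorname{dom}(F)$ and $x\mapsto+\infty$ otherwise is $\tau$-lower semicontinuous on $X$ and norm upper semicontinuous on $\operatorname{dom}(F)$. (2) $\Omega:X\to\mathbb{R}\cup\{+\infty\}$ has effective domain $\operatorname{dom}(\Omega)=\{x\in X:\Omega(x)<\infty\}\supseteq\operatorname{dom}(F)$, and $\Omega$ is $\tau$-lower semicontinuous on $X$ and norm upper semicontinuous on $\operatorname{dom}(\Omega)$. (3) $y\in Y$, $\alpha\in[0,\infty)$, $p\in[1,\infty)$. (4) For each $n\in\mathbb{N}$, $F_n:\operatorname{dom}(F_n)\to Y$ is an operator with $\operatorname{dom}(F_n)\subseteq\operatorname{dom}(F)$; $\operatorname{dom}(F_n)\subseteq\operatorname{dom}(F_{n+1})$ for all $n$; and $\bigcup_{n}\operatorname{dom}(F_n)$ is norm dense in $\operatorname{dom}(F)$. (5) $(F_n)$ converges to $F$ locally uniformly with respect to $\tau$ on the $\tau$-closure $\overline{\operatorname{dom}(F)}^{\tau}$: for each $x\in\overline{\operatorname{dom}(F)}^{\tau}$ there is a $\tau$-open neighborhood $U$ of $x$ with $\lim_{n\to\infty}\sup_{x'\in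 U\cap\operatorname{dom}(F_n)}\|F_n(x')-F(x')\|_Y=0$ (the set $U\cap\operatorname{dom}(F_n)$ is nonempty for large $n$ by the density assumption). (6) $(y_n)$ is a sequence in $Y$ with $\|y_n-y\|_Y\to0$, and $(\alpha_n)$ is a sequence in $(0,\infty)$ converging to $\alpha$. "Upper semicontinuous on a subset $S$" refers to the restriction of the function to $S$. $\Gamma$-convergence. For a topological space $X$ and functionals $f_j:X\to[-\infty,+\infty]$, with $\mathcal{N}(x)$ the set of open neighborhoods of $x$, put $$(\Gamma\text{-}\liminf_{j} f_j)(x)=\sup_{U\in\mathcal{N}(x)}\liminf_{j\to\infty}\inf_{x'\in U}f_j(x'),\qquad(\Gamma\text{-}\limsup_{j} f_j)(x)=\sup_{U\in\mathcal{N}(x)}\limsup_{j\to\infty}\inf_{x'\in U}f_j(x').$$ $(f_j)$ $\Gamma$-converges to $f:X\to[-\infty,+\infty]$ if both are equal to $f(x)$ for every $x\in X$. *)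

theory Defs
  imports "HOL-Analysis.Analysis"
begin

section \<open>Weak and weak* topologies\<close>

text \<open>The coarsest topology for which all bounded linear functionals are continuous, obtained by
  pulling back the product topology along the evaluation map.\<close>

definition weak_topology :: "'a::real_normed_vector topology" where
  "weak_topology = pullback_topology UNIV (\<lambda>x (\<phi> :: 'a \<Rightarrow>\<^sub>L real). blinfun_apply \<phi> x) euclidean"

text \<open>A Banach space \<open>'a\<close> is a dual space if it is identified, by an isometric
  isomorphism \<open>J\<close>, with the dual \<open>'z \<Rightarrow>\<^sub>L real\<close> of a normed space \<open>'z\<close>. The weak* topology
  depends on this identification. On the dual itself it is the topology of pointwise
  convergence, i.e. the strong operator topology for scalar-valued operators.\<close>

definition dual_identification :: "('a::real_normed_vector \<Rightarrow> ('z::real_normed_vector \<Rightarrow>\<^sub>L real)) \<Rightarrow> bool" where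
  "dual_identification J \<longleftrightarrow> linear J \<and> (\<forall>x. norm (J x) = norm x) \<and> surj J"

definition weak_star_topology ::
  "('a::real_normed_vector \<Rightarrow> ('z::real_normed_vector \<Rightarrow>\<^sub>L real)) \<Rightarrow> 'a topology" where
  "weak_star_topology J = pullback_topology UNIV J strong_operator_topology"


section \<open>Semicontinuity of extended real-valued functions\<close>

definition lower_semicontinuous :: "'a topology \<Rightarrow> ('a \<Rightarrow> ereal) \<Rightarrow> bool" where
  "lower_semicontinuous \<tau> f \<longleftrightarrow> (\<forall>c. openin \<tau> {x \<in> topspace \<tau>. c < f x})"

definition upper_semicontinuous :: "'a topology \<Rightarrow> ('a \<Rightarrow> ereal) \<Rightarrow> bool" where
  "upper_semicontinuous \<tau> f \<longleftrightarrow> (\<forall>c. openin \<tau> {x \<in> topspace \<tau>. f x < c})"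


section \<open>Gamma-convergence\<close>

definition Gamma_liminf :: "'a topology \<Rightarrow> (nat \<Rightarrow> 'a \<Rightarrow> ereal) \<Rightarrow> 'a \<Rightarrow> ereal" where
  "Gamma_liminf \<tau> f x = (SUP U \<in> {U. openin \<tau> U \<and> x \<in> U}. liminf (\<lambda>j. INF x'\<in>U. f j x'))"

definition Gamma_limsup :: "'a topology \<Rightarrow> (nat \<Rightarrow> 'a \<Rightarrow> ereal) \<Rightarrow> 'a \<Rightarrow> ereal" where
  "Gamma_limsup \<tau> f x = (SUP U \<in> {U. openin \<tau> U \<and> x \<in> U}. limsup (\<lambda>j. INF x'\<in>U. f j x'))"

definition Gamma_converges :: "'a topology \<Rightarrow> (nat \<Rightarrow> 'a \<Rightarrow> ereal) \<Rightarrow> ('a \<Rightarrow> ereal) \<Rightarrow> bool" where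
  "Gamma_converges \<tau> f g \<longleftrightarrow>
     (\<forall>x \<in> topspace \<tau>. Gamma_liminf \<tau> f x = g x \<and> Gamma_limsup \<tau> f x = g x)"


section \<open>Partially defined operators and Tikhonov functionals\<close>

text \<open>An operator with domain \<open>D\<close> is a total function together with the set \<open>D\<close>; its values
  outside \<open>D\<close> are never used.\<close>

definition residual :: "'a set \<Rightarrow> ('a \<Rightarrow> 'b::real_normed_vector) \<Rightarrow> 'b \<Rightarrow> 'a \<Rightarrow> ereal" where
  "residual D F z x = (if x \<in> D then ereal (norm (F x - z)) else \<infinity>)"

definition effective_domain :: "('a \<Rightarrow> ereal) \<Rightarrow> 'a set" where
  "effective_domain \<Omega> = {x. \<Omega> x < \<infinity>}"

definition tikhonov ::
  "real \<Rightarrow> ('a \<Rightarrow> ereal) \<Rightarrow> 'a set \<Rightarrow> ('a \<Rightarrow> 'b::real_normed_vector) \<Rightarrow> 'b \<Rightarrow> real \<Rightarrow> 'a \<Rightarrow> ereal" where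
  "tikhonov p \<Omega> D F y \<alpha> x =
     (if x \<in> D then ereal (1 / p * norm (F x - y) powr p) + ereal \<alpha> * \<Omega> x else \<infinity>)"

text \<open>The supremum is taken in the extended reals. It may be \<open>\<infinity>\<close>, and it is \<open>-\<infinity>\<close> when
  \<open>U \<inter> Dn n\<close> is empty, but since the limit is \<open>0\<close> this happens for only finitely many \<open>n\<close>.\<close>

definition locally_uniform_convergence ::
  "'a topology \<Rightarrow> 'a set \<Rightarrow> (nat \<Rightarrow> 'a set) \<Rightarrow> (nat \<Rightarrow> 'a \<Rightarrow> 'b::real_normed_vector) \<Rightarrow> ('a \<Rightarrow> 'b) \<Rightarrow> bool" where
  "locally_uniform_convergence \<tau> S Dn Fn F \<longleftrightarrow>
     (\<forall>x \<in> S. \<exists>U. openin \<tau> U \<and> x \<in> U \<and>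
        (\<lambda>n. SUP x' \<in> U \<inter> Dn n. ereal (norm (Fn n x' - F x'))) \<longlonglongrightarrow> 0)"

end

theory Submission
  imports Defs
begin

text \<open>For the lower bound, lower semicontinuity of the residual and of \<open>\<Omega>\<close> gives real constants
  \<open>a\<close>, \<open>b\<close> bounding them from below near \<open>x\<close> such that \<open>max 0 a powr p / p + \<alpha> * b\<close> is still
  above a prescribed \<open>c < T x\<close>; locally uniform convergence transfers the bound to \<open>T\<^sub>n\<close>.
  For the upper bound, density and norm upper semicontinuity yield, in each neighbourhood of
  \<open>x \<in> D\<close>, a point \<open>x'\<close> of some \<open>Dn N\<close> with \<open>T x' < c\<close> for prescribed \<open>c > T x\<close>. As the
  domains increase, the constant sequence \<open>x'\<close> has \<open>T\<^sub>n x' \<rightarrow> T x'\<close>, which suffices.\<close>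

section \<open>Comparison of the weak and weak* topologies with the norm topology\<close>

lemma topspace_weak_topology [simp]: "topspace weak_topology = UNIV"
  by (simp add: weak_topology_def topspace_pullback_topology)

text \<open>Each coordinate \<open>x \<mapsto> \<phi> x\<close> of the evaluation map is norm
  continuous, hence so is the map into the product. This lets density and upper semicontinuity, both
  stated for the norm, act inside weak neighbourhoods.\<close>

lemma openin_weak_topology_imp_open:
  assumes "openin weak_topology (U :: 'a::real_normed_vector set)"
  shows "open U"
proof -
  obtain V where V: "open V" "U = (\<lambda>x (\<phi> :: 'a \<Rightarrow>\<^sub>L real). blinfun_apply \<phi> x) -` V"
    using assms by (auto simp: weak_topology_def openin_pullback_topology)
  have "continuous_on UNIV (\<lambda>x (\<phi> :: 'a \<Rightarrow>\<^sub>L real). blinfun_apply \<phi> x)"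
    by (intro continuous_on_coordinatewise_then_product continuous_intros)
  then show ?thesis
    using V by (simp add: open_vimage)
qed

lemma topspace_weak_star_topology [simp]: "topspace (weak_star_topology J) = UNIV"
  by (simp add: weak_star_topology_def topspace_pullback_topology strong_operator_topology_topspace)

text \<open>The isometry \<open>J\<close> is bounded, and the strong operator topology is coarser
  than the operator norm topology, so preimages under \<open>J\<close> of its open sets are norm
  open.\<close>

lemma openin_weak_star_topology_imp_open:
  assumes "dual_identification J" "openin (weak_star_topology J) U"
  shows "open U"
proof -
  obtain V where V: "openin strong_operator_topology V" "U = J -` V"
    using assms(2) by (auto simp: weak_star_topology_def openin_pullback_topology)
  have "bounded_linear J"
    using assms(1) unfolding dual_identification_def
    by (intro bounded_linear_intro[of J 1]) (auto simp: linear_add linear_scale)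
  then have "continuous_on UNIV J"
    by (simp add: linear_continuous_on)
  moreover have "open V"
    using strong_operator_topology_weaker_than_euclidean V(1)
    by (auto simp: continuous_map_def)
  ultimately show ?thesis
    using V(2) by (simp add: open_vimage)
qed

section \<open>Criteria for Gamma-limits\<close>

lemma Gamma_liminf_le_limsup: "Gamma_liminf \<tau> f x \<le> Gamma_limsup \<tau> f x"
  unfolding Gamma_liminf_def Gamma_limsup_def
  by (intro SUP_mono) (auto intro!: Liminf_le_Limsup)

text \<open>The lower Gamma-limit is a supremum over neighbourhoods, so one good \<open>U\<close>
  per level suffices. Real levels are enough because the reals are order dense in
  \<open>ereal\<close>.\<close>

lemma Gamma_liminf_geI:
  assumes "\<And>c::real. ereal c < g \<Longrightarrow>
    \<exists>U. openin \<tau> U \<and> x \<in> U \<and> (\<forall>\<^sub>F n in sequentially. \<forall>x'\<in>U. ereal c \<le> f n x')"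
  shows "g \<le> Gamma_liminf \<tau> f x"
proof (rule ccontr)
  assume "\<not> g \<le> Gamma_liminf \<tau> f x"
  then obtain c where c: "Gamma_liminf \<tau> f x < ereal c" "ereal c < g"
    using ereal_dense2 by (meson not_le)
  then obtain U where U: "openin \<tau> U" "x \<in> U" 
      "\<forall>\<^sub>F n in sequentially. \<forall>x'\<in>U. ereal c \<le> f n x'"
    using assms by blast
  have "ereal c \<le> liminf (\<lambda>n. INF x'\<in>U. f n x')"
    by (rule Liminf_bounded) (use U(3) in eventually_elim, auto intro: INF_greatest)
  also have "\<dots> \<le> Gamma_liminf \<tau> f x"
    unfolding Gamma_liminf_def by (rule SUP_upper) (use U in auto)
  finally show False
    using c by simp
qed

text \<open>The infimum over \<open>U\<close> lies below the value at any fixed point of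
  \<open>U\<close>. Hence a point chosen independently of \<open>n\<close> suffices, in place of a
  recovery sequence converging to \<open>x\<close>.\<close>

lemma Gamma_limsup_leI:
  assumes "\<And>(c::real) U. \<lbrakk>g < ereal c; openin \<tau> U; x \<in> U\<rbrakk> \<Longrightarrow>
    \<exists>x'\<in>U. limsup (\<lambda>n. f n x') \<le> ereal c"
  shows "Gamma_limsup \<tau> f x \<le> g"
  unfolding Gamma_limsup_def
proof (rule SUP_least)
  fix U assume U: "U \<in> {U. openin \<tau> U \<and> x \<in> U}"
  show "limsup (\<lambda>n. INF x'\<in>U. f n x') \<le> g"
  proof (rule ccontr)
    assume "\<not> limsup (\<lambda>n. INF x'\<in>U. f n x') \<le> g"
    then obtain c where c: "g < ereal c" "ereal c < limsup (\<lambda>n. INF x'\<in>U. f n x')"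
      using ereal_dense2 by (meson not_le)
    then obtain x' where x': "x' \<in> U" "limsup (\<lambda>n. f n x') \<le> ereal c"
      using assms U by blast
    have "limsup (\<lambda>n. INF x'\<in>U. f n x') \<le> limsup (\<lambda>n. f n x')"
      by (intro Limsup_mono always_eventually allI INF_lower x')
    with x'(2) c(2) show False
      by simp
  qed
qed

section \<open>Neighbourhoods from semicontinuity and locally uniform convergence\<close>

lemma lower_semicontinuousD:
  assumes "lower_semicontinuous \<tau> f" "x \<in> topspace \<tau>" "c < f x"
  obtains U where "openin \<tau> U" "x \<in> U" "\<And>x'. x' \<in> U \<Longrightarrow> c < f x'"
  using assms unfolding lower_semicontinuous_def by blast

lemma upper_semicontinuous_top_of_setD:
  fixes S :: "'a::topological_space set"
  assumes "upper_semicontinuous (top_of_set S) f" "x \<in> S" "f x < c"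
  obtains W where "open W" "x \<in> W" "\<And>x'. x' \<in> W \<inter> S \<Longrightarrow> f x' < c"
proof -
  have "openin (top_of_set S) {x' \<in> S. f x' < c}"
    using assms(1) by (simp add: upper_semicontinuous_def)
  then obtain W where "open W" "{x' \<in> S. f x' < c} = S \<inter> W"
    by (auto simp: openin_open)
  then show ?thesis
    using that[of W] assms(2,3) by blast
qed

text \<open>Replaces the extended real supremum by pointwise bounds, with one \<open>U\<close>
  serving every \<open>e\<close>. Where \<open>U \<inter> Dn n\<close> is empty the bound is
  vacuous.\<close>

lemma locally_uniform_convergenceD:
  assumes "locally_uniform_convergence \<tau> S Dn Fn F" "x \<in> S"
  obtains U where "openin \<tau> U" "x \<in> U"
    "\<And>e. 0 < e \<Longrightarrow> \<forall>\<^sub>F n in sequentially. \<forall>x' \<in> U \<inter> Dn n. norm (Fn n x' - F x') < e"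
proof -
  obtain U where U: "openin \<tau> U" "x \<in> U"
    "(\<lambda>n. SUP x' \<in> U \<inter> Dn n. ereal (norm (Fn n x' - F x'))) \<longlonglongrightarrow> 0"
    using assms unfolding locally_uniform_convergence_def by blast
  have "\<forall>\<^sub>F n in sequentially. \<forall>x' \<in> U \<inter> Dn n. norm (Fn n x' - F x') < e" if "0 < e" for e
  proof -
    have "\<forall>\<^sub>F n in sequentially. (SUP x' \<in> U \<inter> Dn n. ereal (norm (Fn n x' - F x'))) < ereal e"
      using that by (intro order_tendstoD(2)[OF U(3)]) (simp add: zero_ereal_def)
    then show ?thesis
    proof eventually_elim
      case (elim n)
      have "ereal (norm (Fn n x' - F x')) < ereal e" if "x' \<in> U \<inter> Dn n" for x'
        using elim SUP_upper[OF that] by (rule le_less_trans[rotated])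
      then show ?case by simp
    qed
  qed
  with U that show ?thesis by blast
qed

section \<open>Estimates for Tikhonov functionals\<close>

text \<open>The case \<open>x \<notin> D\<close> is included, where the residual is \<open>\<infinity>\<close> and \<open>a\<close> is taken large.\<close>

lemma tikhonov_lower_constants:
  assumes p: "1 \<le> p" and proper: "\<Omega> x \<noteq> -\<infinity>" and fin: "x \<in> D \<Longrightarrow> \<Omega> x < \<infinity>"
    and c: "ereal c < tikhonov p \<Omega> D F y \<alpha> x"
  obtains a b where "ereal a < residual D F y x" "ereal b < \<Omega> x"
    "c < 1 / p * max 0 a powr p + \<alpha> * b"
proof (cases "x \<in> D")
  case True
  then obtain w where w: "\<Omega> x = ereal w"
    using proper fin by (cases "\<Omega> x") auto
  define r where "r = norm (F x - y)"
  \<comment> \<open>Lowering both \<open>r\<close> and \<open>w\<close> by the same small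
    \<open>e\<close> keeps the strict inequality, by continuity at \<open>e = 0\<close>. The
    \<open>max 0\<close> keeps the base of the power nonnegative when \<open>r = 0\<close>.\<close>
  have "((\<lambda>e. 1 / p * max 0 (r - e) powr p + \<alpha> * (w - e)) \<longlongrightarrow>
      1 / p * max 0 (r - 0) powr p + \<alpha> * (w - 0)) (at_right 0)"
    using p by (intro tendsto_intros tendsto_powr') auto
  moreover have "c < 1 / p * max 0 (r - 0) powr p + \<alpha> * (w - 0)"
    using c True w by (simp add: tikhonov_def r_def)
  ultimately have "\<forall>\<^sub>F e in at_right 0. c < 1 / p * max 0 (r - e) powr p + \<alpha> * (w - e)"
    by (rule order_tendstoD(1))
  moreover have "\<forall>\<^sub>F e in at_right 0. (0::real) < e"
    by (rule eventually_at_right_less)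
  ultimately have "\<forall>\<^sub>F e in at_right 0. 0 < e \<and> c < 1 / p * max 0 (r - e) powr p + \<alpha> * (w - e)"
    by eventually_elim auto
  then obtain e where "0 < e" "c < 1 / p * max 0 (r - e) powr p + \<alpha> * (w - e)"
    using eventually_happens'[OF trivial_limit_at_right_real] by blast
  with True w show ?thesis
    by (intro that[of "r - e" "w - e"]) (auto simp: residual_def r_def)
next
  case False
  obtain b where b: "ereal b < \<Omega> x"
    using proper ereal_dense2[of "-\<infinity>" "\<Omega> x"] by (cases "\<Omega> x") auto
  \<comment> \<open>The factor \<open>p\<close> cancels \<open>1 / p\<close>, and
    \<open>a \<ge> 1\<close> gives \<open>a \<le> a powr p\<close>. The power term is thus at least
    \<open>\<bar>c - \<alpha> * b\<bar> + 1\<close>, which beats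
    \<open>c - \<alpha> * b\<close>.\<close>
  define a where "a = p * (\<bar>c - \<alpha> * b\<bar> + 1)"
  have "1 * 1 \<le> a"
    unfolding a_def using p by (intro mult_mono) auto
  then have "a powr 1 \<le> a powr p"
    using p by (intro powr_mono) auto
  then have "1 / p * a \<le> 1 / p * a powr p"
    using p \<open>1 * 1 \<le> a\<close> by (intro mult_left_mono) auto
  moreover have "1 / p * a = \<bar>c - \<alpha> * b\<bar> + 1"
    using p by (simp add: a_def)
  ultimately have "c < 1 / p * max 0 a powr p + \<alpha> * b"
    using \<open>1 * 1 \<le> a\<close> by (simp add: max_def)
  with False b show ?thesis
    by (intro that[of a b]) (auto simp: residual_def)
qed

text \<open>Off the closure of \<open>D\<close> some neighbourhood misses every \<open>Dn n\<close>,
  so all approximate functionals are \<open>\<infinity>\<close> there. On the closure, locally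
  uniform convergence carries the lower bound for the residual of \<open>F\<close> over to that of
  \<open>Fn n\<close>.\<close>

lemma tikhonov_eventually_ge_nhds:
  fixes F :: "'a \<Rightarrow> 'b::real_normed_vector"
  assumes x: "x \<in> topspace \<tau>"
    and F_lsc: "lower_semicontinuous \<tau> (residual D F y)"
    and proper: "\<Omega> x \<noteq> -\<infinity>" and D_Omega: "D \<subseteq> effective_domain \<Omega>"
    and Omega_lsc: "lower_semicontinuous \<tau> \<Omega>"
    and p: "1 \<le> p"
    and Dn_subset: "\<And>n. Dn n \<subseteq> D"
    and Fn_conv: "locally_uniform_convergence \<tau> (\<tau> closure_of D) Dn Fn F"
    and yn_conv: "yn \<longlonglongrightarrow> y"
    and alphan_pos: "\<And>n. 0 < \<alpha>n n" and alphan_conv: "\<alpha>n \<longlonglongrightarrow> \<alpha>"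
    and c: "ereal c < tikhonov p \<Omega> D F y \<alpha> x"
  shows "\<exists>U. openin \<tau> U \<and> x \<in> U \<and>
    (\<forall>\<^sub>F n in sequentially. \<forall>x'\<in>U. ereal c \<le> tikhonov p \<Omega> (Dn n) (Fn n) (yn n) (\<alpha>n n) x')"
proof (cases "x \<in> \<tau> closure_of D")
  case False
  then obtain U where "openin \<tau> U" "x \<in> U" "U \<inter> D = {}"
    using x by (auto simp: in_closure_of)
  moreover from this Dn_subset have "x' \<notin> Dn n" if "x' \<in> U" for x' n
    using that by blast
  ultimately show ?thesis
    by (intro exI[of _ U]) (auto simp: tikhonov_def)
next
  case True
  obtain a b where a: "ereal a < residual D F y x" and b: "ereal b < \<Omega> x"
    and ab: "c < 1 / p * max 0 a powr p + \<alpha> * b"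
    using tikhonov_lower_constants[OF p proper _ c] D_Omega
    by (auto simp: effective_domain_def subset_iff)
  obtain a' where a': "ereal a < ereal a'" "ereal a' < residual D F y x"
    using ereal_dense2[OF a] by blast
  define e where "e = (a' - a) / 2"
  have e: "0 < e"
    using a'(1) by (simp add: e_def)
  obtain U1 where U1: "openin \<tau> U1" "x \<in> U1" "\<And>x'. x' \<in> U1 \<Longrightarrow> ereal a' < residual D F y x'"
    using lower_semicontinuousD[OF F_lsc x a'(2)] by blast
  obtain U2 where U2: "openin \<tau> U2" "x \<in> U2" "\<And>x'. x' \<in> U2 \<Longrightarrow> ereal b < \<Omega> x'"
    using lower_semicontinuousD[OF Omega_lsc x b] by blast
  obtain U3 where U3: "openin \<tau> U3" "x \<in> U3"
    "\<And>e. 0 < e \<Longrightarrow> \<forall>\<^sub>F n in sequentially. \<forall>x' \<in> U3 \<inter> Dn n. norm (Fn n x' - F x') < e"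
    using locally_uniform_convergenceD[OF Fn_conv True] by blast
  \<comment> \<open>Since \<open>b\<close> is a real constant, its sign is irrelevant for this
    limit; only the weights vary with \<open>n\<close>.\<close>
  have "(\<lambda>n. 1 / p * max 0 a powr p + \<alpha>n n * b) \<longlonglongrightarrow> 1 / p * max 0 a powr p + \<alpha> * b"
    by (intro tendsto_intros alphan_conv)
  then have "\<forall>\<^sub>F n in sequentially. c < 1 / p * max 0 a powr p + \<alpha>n n * b"
    using ab by (rule order_tendstoD(1))
  moreover have "\<forall>\<^sub>F n in sequentially. norm (yn n - y) < e"
    using tendstoD[OF yn_conv e] by (simp add: dist_norm)
  ultimately have "\<forall>\<^sub>F n in sequentially. \<forall>x'\<in>U1 \<inter> U2 \<inter> U3.
      ereal c \<le> tikhonov p \<Omega> (Dn n) (Fn n) (yn n) (\<alpha>n n) x'"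
    using U3(3)[OF e]
  proof eventually_elim
    case (elim n)
    show ?case
    proof
      fix x' assume x': "x' \<in> U1 \<inter> U2 \<inter> U3"
      show "ereal c \<le> tikhonov p \<Omega> (Dn n) (Fn n) (yn n) (\<alpha>n n) x'"
      proof (cases "x' \<in> Dn n")
        case True
        then have "x' \<in> D" "\<Omega> x' < \<infinity>"
          using Dn_subset D_Omega by (auto simp: effective_domain_def)
        moreover have "ereal b < \<Omega> x'"
          using U2(3) x' by blast
        ultimately obtain w where w: "\<Omega> x' = ereal w" "b < w"
          by (cases "\<Omega> x'") auto
        have "a' < norm (F x' - y)"
          using U1(3)[of x'] x' \<open>x' \<in> D\<close> by (simp add: residual_def)
        also have "F x' - y = (Fn n x' - yn n) - (Fn n x' - F x') + (yn n - y)"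
          by simp
        also have "norm \<dots> \<le> norm (Fn n x' - yn n) + norm (Fn n x' - F x') + norm (yn n - y)"
          by (meson add_right_mono norm_triangle_ineq norm_triangle_ineq4 order_trans)
        also have "\<dots> < norm (Fn n x' - yn n) + e + e"
          using elim(2,3) x' True by (smt (verit) IntD2 IntI)
        \<comment> \<open>Here \<open>a' - 2 * e = a\<close>, and the norm is nonnegative.\<close>
        finally have "max 0 a \<le> norm (Fn n x' - yn n)"
          by (simp add: e_def)
        then have "max 0 a powr p \<le> norm (Fn n x' - yn n) powr p"
          using p by (intro powr_mono2) auto
        then have "1 / p * max 0 a powr p \<le> 1 / p * norm (Fn n x' - yn n) powr p"
          using p by (intro mult_left_mono) auto
        moreover have "\<alpha>n n * b \<le> \<alpha>n n * w"
          using alphan_pos[of n] w(2) by (intro mult_left_mono) auto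
        ultimately have "c \<le> 1 / p * norm (Fn n x' - yn n) powr p + \<alpha>n n * w"
          using elim(1) by linarith
        then show ?thesis
          using True w(1) by (simp add: tikhonov_def)
      qed (simp add: tikhonov_def)
    qed
  qed
  then show ?thesis
    using U1 U2 U3 by (intro exI[of _ "U1 \<inter> U2 \<inter> U3"]) auto
qed

text \<open>On \<open>D\<close> both the residual and \<open>\<Omega>\<close> are finite and norm
  upper semicontinuous, and the functional is monotone in each of them because \<open>p > 0\<close>
  and \<open>\<alpha> \<ge> 0\<close>.\<close>

lemma tikhonov_less_nhds:
  fixes D :: "'a::topological_space set" and F :: "'a \<Rightarrow> 'b::real_normed_vector"
  assumes x: "x \<in> D"
    and F_usc: "upper_semicontinuous (top_of_set D) (residual D F y)"
    and proper: "\<And>x. \<Omega> x \<noteq> -\<infinity>" and D_Omega: "D \<subseteq> effective_domain \<Omega>"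
    and Omega_usc: "upper_semicontinuous (top_of_set (effective_domain \<Omega>)) \<Omega>"
    and \<alpha>: "0 \<le> \<alpha>" and p: "1 \<le> p"
    and c: "tikhonov p \<Omega> D F y \<alpha> x < ereal c"
  obtains W where "open W" "x \<in> W" "\<And>x'. x' \<in> W \<inter> D \<Longrightarrow> tikhonov p \<Omega> D F y \<alpha> x' < ereal c"
proof -
  obtain w where w: "\<Omega> x = ereal w"
    using proper[of x] D_Omega x by (cases "\<Omega> x") (auto simp: effective_domain_def)
  define r where "r = norm (F x - y)"
  \<comment> \<open>A common slack \<open>e\<close> for residual and penalty, obtained from
    continuity at \<open>e = 0\<close>.\<close>
  have "((\<lambda>e. 1 / p * (r + e) powr p + \<alpha> * (w + e)) \<longlongrightarrow>
      1 / p * (r + 0) powr p + \<alpha> * (w + 0)) (at_right 0)"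
    using p by (intro tendsto_intros tendsto_powr')
      (auto simp: r_def intro!: eventually_mono[OF eventually_at_right_less])
  moreover have "1 / p * (r + 0) powr p + \<alpha> * (w + 0) < c"
    using c x w by (simp add: tikhonov_def r_def)
  ultimately have "\<forall>\<^sub>F e in at_right 0. 1 / p * (r + e) powr p + \<alpha> * (w + e) < c"
    by (rule order_tendstoD(2))
  moreover have "\<forall>\<^sub>F e in at_right 0. (0::real) < e"
    by (rule eventually_at_right_less)
  ultimately have "\<forall>\<^sub>F e in at_right 0. 0 < e \<and> 1 / p * (r + e) powr p + \<alpha> * (w + e) < c"
    by eventually_elim auto
  then obtain e where e: "0 < e" "1 / p * (r + e) powr p + \<alpha> * (w + e) < c"
    using eventually_happens'[OF trivial_limit_at_right_real] by blast
  have "residual D F y x < ereal (r + e)"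
    using x e(1) by (simp add: residual_def r_def)
  then obtain W1 where W1: "open W1" "x \<in> W1"
      "\<And>x'. x' \<in> W1 \<inter> D \<Longrightarrow> residual D F y x' < ereal (r + e)"
    using upper_semicontinuous_top_of_setD[OF F_usc x] by blast
  have "\<Omega> x < ereal (w + e)"
    using w e(1) by simp
  moreover have "x \<in> effective_domain \<Omega>"
    using x D_Omega by blast
  ultimately obtain W2 where W2: "open W2" "x \<in> W2"
      "\<And>x'. x' \<in> W2 \<inter> effective_domain \<Omega> \<Longrightarrow> \<Omega> x' < ereal (w + e)"
    using upper_semicontinuous_top_of_setD[OF Omega_usc] by blast
  have "tikhonov p \<Omega> D F y \<alpha> x' < ereal c" if x': "x' \<in> (W1 \<inter> W2) \<inter> D" for x'
  proof -
    have "\<Omega> x' < ereal (w + e)"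
      using W2(3) x' D_Omega by blast
    then obtain w' where w': "\<Omega> x' = ereal w'" "w' < w + e"
      using proper[of x'] by (cases "\<Omega> x'") auto
    have "norm (F x' - y) < r + e"
      using W1(3)[of x'] x' by (simp add: residual_def)
    then have "norm (F x' - y) powr p \<le> (r + e) powr p"
      using p by (intro powr_mono2) auto
    then have "1 / p * norm (F x' - y) powr p \<le> 1 / p * (r + e) powr p"
      using p by (intro mult_left_mono) auto
    moreover have "\<alpha> * w' \<le> \<alpha> * (w + e)"
      using \<alpha> w'(2) by (intro mult_left_mono) auto
    ultimately have "1 / p * norm (F x' - y) powr p + \<alpha> * w' < c"
      using e(2) by linarith
    then show ?thesis
      using x' w'(1) by (simp add: tikhonov_def)
  qed
  with W1 W2 show ?thesis
    by (intro that[of "W1 \<inter> W2"]) auto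
qed

text \<open>At a fixed point lying in \<open>Dn n\<close> for all large \<open>n\<close>, with
  \<open>\<Omega> x\<close> finite, the limit reduces to one of real sequences.\<close>

lemma tikhonov_tendsto:
  fixes F :: "'a \<Rightarrow> 'b::real_normed_vector"
  assumes p: "0 < p" and fin: "\<bar>\<Omega> x\<bar> \<noteq> \<infinity>" and x: "x \<in> D" "\<forall>\<^sub>F n in sequentially. x \<in> Dn n"
    and lim: "(\<lambda>n. Fn n x) \<longlonglongrightarrow> F x" "yn \<longlonglongrightarrow> y" "\<alpha>n \<longlonglongrightarrow> \<alpha>"
  shows "(\<lambda>n. tikhonov p \<Omega> (Dn n) (Fn n) (yn n) (\<alpha>n n) x) \<longlonglongrightarrow> tikhonov p \<Omega> D F y \<alpha> x"
proof -
  obtain w where w: "\<Omega> x = ereal w"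
    using fin by (cases "\<Omega> x") auto
  have "(\<lambda>n. 1 / p * norm (Fn n x - yn n) powr p + \<alpha>n n * w) \<longlonglongrightarrow>
      1 / p * norm (F x - y) powr p + \<alpha> * w"
    using p by (intro tendsto_intros tendsto_powr' lim) auto
  then have "(\<lambda>n. ereal (1 / p * norm (Fn n x - yn n) powr p + \<alpha>n n * w)) \<longlonglongrightarrow>
      tikhonov p \<Omega> D F y \<alpha> x"
    using x(1) w by (simp add: tikhonov_def)
  moreover have "\<forall>\<^sub>F n in sequentially. ereal (1 / p * norm (Fn n x - yn n) powr p + \<alpha>n n * w) =
      tikhonov p \<Omega> (Dn n) (Fn n) (yn n) (\<alpha>n n) x"
    using x(2) by eventually_elim (simp add: tikhonov_def w)
  ultimately show ?thesis
    by (rule Lim_transform_eventually)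
qed

section \<open>Gamma-convergence of the Tikhonov functionals\<close>

theorem theorem3p3:
  fixes \<tau> :: "'a::banach topology"
    and J :: "'a \<Rightarrow> ('z::real_normed_vector \<Rightarrow>\<^sub>L real)"
    and D :: "'a set" and F :: "'a \<Rightarrow> 'b::banach"
    and Dn :: "nat \<Rightarrow> 'a set" and Fn :: "nat \<Rightarrow> 'a \<Rightarrow> 'b"
    and \<Omega> :: "'a \<Rightarrow> ereal"
    and y :: 'b and yn :: "nat \<Rightarrow> 'b"
    and \<alpha> p :: real and \<alpha>n :: "nat \<Rightarrow> real"
  assumes topology: "\<tau> = euclidean \<or> \<tau> = weak_topology \<or>
                     (dual_identification J \<and> \<tau> = weak_star_topology J)"
    and D_nonempty: "D \<noteq> {}"
    and F_lsc: "\<And>z. lower_semicontinuous \<tau> (residual D F z)"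
    and F_usc: "\<And>z. upper_semicontinuous (top_of_set D) (residual D F z)"
    and Omega_proper: "\<And>x. \<Omega> x \<noteq> -\<infinity>"
    and D_Omega: "D \<subseteq> effective_domain \<Omega>"
    and Omega_lsc: "lower_semicontinuous \<tau> \<Omega>"
    and Omega_usc: "upper_semicontinuous (top_of_set (effective_domain \<Omega>)) \<Omega>"
    and alpha_nonneg: "0 \<le> \<alpha>"
    and p_ge_1: "1 \<le> p"
    and Dn_subset: "\<And>n. Dn n \<subseteq> D"
    and Dn_mono: "\<And>n. Dn n \<subseteq> Dn (Suc n)"
    and Dn_dense: "D \<subseteq> closure (\<Union>n. Dn n)"
    and Fn_conv: "locally_uniform_convergence \<tau> (\<tau> closure_of D) Dn Fn F"
    and yn_conv: "(\<lambda>n. norm (yn n - y)) \<longlonglongrightarrow> 0"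
    and alphan_pos: "\<And>n. 0 < \<alpha>n n"
    and alphan_conv: "\<alpha>n \<longlonglongrightarrow> \<alpha>"
  shows "Gamma_converges \<tau> (\<lambda>n. tikhonov p \<Omega> (Dn n) (Fn n) (yn n) (\<alpha>n n)) (tikhonov p \<Omega> D F y \<alpha>)"
proof -
  have top: "topspace \<tau> = UNIV"
    using topology by auto
  have coarser: "open U" if "openin \<tau> U" for U
    using topology that openin_weak_topology_imp_open openin_weak_star_topology_imp_open
    by (metis open_openin)
  have yn: "yn \<longlonglongrightarrow> y"
    using yn_conv by (simp add: LIM_zero_iff tendsto_norm_zero_iff)
  let ?T = "tikhonov p \<Omega> D F y \<alpha>"
  let ?Tn = "\<lambda>n. tikhonov p \<Omega> (Dn n) (Fn n) (yn n) (\<alpha>n n)"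
  have liminf: "?T x \<le> Gamma_liminf \<tau> ?Tn x" for x
    using top by (intro Gamma_liminf_geI tikhonov_eventually_ge_nhds[OF _ F_lsc Omega_proper
          D_Omega Omega_lsc p_ge_1 Dn_subset Fn_conv yn alphan_pos alphan_conv]) auto
  have limsup: "Gamma_limsup \<tau> ?Tn x \<le> ?T x" for x
  proof (rule Gamma_limsup_leI)
    fix c U assume c: "?T x < ereal c" and U: "openin \<tau> U" "x \<in> U"
    then have x: "x \<in> D"
      by (auto simp: tikhonov_def split: if_splits)
    then obtain W where W: "open W" "x \<in> W" "\<And>x'. x' \<in> W \<inter> D \<Longrightarrow> ?T x' < ereal c"
      using tikhonov_less_nhds[OF _ F_usc Omega_proper D_Omega Omega_usc
          alpha_nonneg p_ge_1 c] by blast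
    \<comment> \<open>\<open>U\<close> is only known to be open in \<open>\<tau>\<close>, while
      \<open>W\<close> and the density refer to the norm; \<open>coarser\<close> makes the
      intersection a norm neighbourhood of \<open>x\<close>.\<close>
    have "open (U \<inter> W)" "x \<in> U \<inter> W" "x \<in> closure (\<Union>n. Dn n)"
      using coarser U W x Dn_dense by auto
    then obtain x' N where x': "x' \<in> U" "x' \<in> W" "x' \<in> Dn N"
      by (metis (no_types, lifting) IntE UN_E closure_iff_nhds_not_empty disjoint_iff order_refl)
    have in_D: "x' \<in> D"
      using x'(3) Dn_subset by blast
    have "x' \<in> Dn n" if "N \<le> n" for n
      using lift_Suc_mono_le[of Dn, OF Dn_mono that] x'(3) by blast
    then have in_Dn: "\<forall>\<^sub>F n in sequentially. x' \<in> Dn n"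
      by (auto simp: eventually_sequentially)
    have "x' \<in> \<tau> closure_of D"
      using in_D top closure_of_subset[of D \<tau>] by auto
    \<comment> \<open>The neighbourhood is taken around \<open>x'\<close>, not \<open>x\<close>, and
      is used only at \<open>z = x'\<close> to get pointwise convergence.\<close>
    then obtain V where V: "openin \<tau> V" "x' \<in> V"
      "\<And>e. 0 < e \<Longrightarrow> \<forall>\<^sub>F n in sequentially. \<forall>z \<in> V \<inter> Dn n. norm (Fn n z - F z) < e"
      using locally_uniform_convergenceD[OF Fn_conv \<open>x' \<in> \<tau> closure_of D\<close>] by blast
    have "(\<lambda>n. Fn n x') \<longlonglongrightarrow> F x'"
    proof (rule tendstoI)
      fix e :: real assume "0 < e"
      from V(3)[OF this] in_Dn show "\<forall>\<^sub>F n in sequentially. dist (Fn n x') (F x') < e"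
        by eventually_elim (use V(2) in \<open>auto simp: dist_norm\<close>)
    qed
    moreover have "\<bar>\<Omega> x'\<bar> \<noteq> \<infinity>"
      using in_D D_Omega Omega_proper[of x'] by (auto simp: effective_domain_def)
    ultimately have "(\<lambda>n. ?Tn n x') \<longlonglongrightarrow> ?T x'"
      using p_ge_1 in_D in_Dn yn alphan_conv by (intro tikhonov_tendsto) auto
    then have "limsup (\<lambda>n. ?Tn n x') = ?T x'"
      by (intro lim_imp_Limsup) auto
    then show "\<exists>x'\<in>U. limsup (\<lambda>n. ?Tn n x') \<le> ereal c"
      using W(3)[of x'] x' in_D by (intro bexI[of _ x']) auto
  qed
  \<comment> \<open>The chain from \<open>?T x\<close> through the lower and upper Gamma-limits back
    to \<open>?T x\<close> forces equality.\<close>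
  show ?thesis
    unfolding Gamma_converges_def
    using liminf limsup Gamma_liminf_le_limsup by (meson order_antisym order_trans)
qed

end
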